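(* Let $\mathbb{D}_{n,s}$ be a positive basis of $\mathbb{R}^n$ of size $s$ that belongs to $\Omega^+$, with partition $\mathbb{D}_{n,s}=\mathbb{D}^n_{m_1}\cup\dots\cup\mathbb{D}^n_{m_{s-n}}$ into pairwise orthogonal minimal sub-positive bases of subspaces $L_1,\dots,L_{s-n}$, $\dim L_i=m_i$, as in the definition of $\Omega^+$. Suppose that the following two properties are satisfied: (i) every minimal sub-positive basis $\mathbb{D}^n_{m_i}$ in the partition is optimal (as a minimal positive basis of $L_i$); (ii) the dimensions $m_i$ satisfy $$m_j=\left\lfloor\frac{n}{s-n}\right\rfloor,\ j\in J,\qquad m_k=\left\lceil\frac{n}{s-n}\right\rceil,\ k\in K,$$ where $J$ and $K$ are disjoint index sets such that $J\cup K=\{1,2,\dots,s-n\}$, $|J|=s-n-\mathrm{rem}\left(\frac{n}{s-n}\right)$ and $|K|=\mathrm{rem}\left(\frac{n}{s-n}\right)$. Then $\mathbb{D}_{n,s}$ is optimal over $\Omega^+$.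
   Context: The positive span $\mathrm{pspan}(S)$ of a finite set $S$ of vectors is the set of linear combinations of elements of $S$ with nonnegative coefficients. A finite set $S$ is positively independent if $d\notin\mathrm{pspan}(S\setminus\{d\})$ for all $d\in S$. A positive basis of a subspace $L$ of $\mathbb{R}^n$ is a positively independent set with positive span equal to $L$. All vectors in positive bases are assumed to be unit vectors. A positive basis of $\mathbb{R}^n$ of size $s$ is written $\mathbb{D}_{n,s}$; necessarily $n+1\le s\le 2n$. A positive basis of an $m$-dimensional space is minimal if it has $m+1$ elements. A sub-positive basis of a subspace $L$ in $\mathbb{R}^n$ is a subset of a positive basis of $\mathbb{R}^n$ with positive span equal to $L$ (so it is a positive basis of $L$). $\mathbb{D}^n_{m}$ denotes a minimal sub-positive basis (size $m+1$) of an $m$-dimensional subspace. The cosine measure of a finite set $S$ of non-zero vectors of $\mathbb{R}^n$ is $\mathrm{cm}(S)=\min_{u\in\mathbb{R}^n,\|u\|=1}\max_{d\in S}\frac{u^\top d}{\|d\|}$. A positive basis $\mathbb{D}_{n,s}$ is optimal over a non-empty set $\mathbb{P}$ of positive bases if $\mathrm{cm}(\mathbb{D}_{n,s})\ge\mathrm{cm}(\mathbb{D}'_{n,s})$ for every positive basis $\mathbb{D}'_{n,s}\in\mathbb{P}$ of size $s$ of $\mathbb{R}^n$. A minimal sub-positive basis of a subspace $L$ is called optimal if it maximizes the cosine measure, computed in $L$ (i.e. with $u$ ranging over unit vectors of $L$), among all minimal positive bases of $L$. $\Omega$ (for given $n,s$) is the set of positive bases $\mathbb{D}_{n,s}$ of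 $\mathbb{R}^n$ that admit a partition $\mathbb{D}_{n,s}=\mathbb{D}^n_{m_1}\cup\dots\cup\mathbb{D}^n_{m_{s-n}}$, where $\mathbb{D}^n_{m_i}$ is a minimal sub-positive basis of a subspace $L_i$ with $1\le\dim L_i=m_i\le n$, $\mathbb{R}^n=L_1\oplus\dots\oplus L_{s-n}$, and $L_i\cap L_j=\{0\}$ for $i\ne j$. $\Omega^+$ is the set of positive bases in $\Omega$ for which the sub-positive bases in such a partition are pairwise orthogonal, i.e. $x^\top y=0$ for all $x\in\mathbb{D}^n_{m_i}$, $y\in\mathbb{D}^n_{m_j}$, $i\neq j$ (no condition if $s-n=1$). $\mathrm{rem}(a/b)$ denotes the remainder of the integer division of $a$ by $b$, and $|I|$ the number of elements of a finite set $I$. *)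

theory Defs
  imports "HOL-Analysis.Analysis"
begin

definition pspan :: "'a::real_vector set \<Rightarrow> 'a set" where
  "pspan S = {(\<Sum>d\<in>S. c d *\<^sub>R d) |c. \<forall>d\<in>S. 0 \<le> (c d :: real)}"

definition positively_independent :: "'a::real_vector set \<Rightarrow> bool" where
  "positively_independent S \<longleftrightarrow> (\<forall>d\<in>S. d \<notin> pspan (S - {d}))"

text \<open>Positive bases consist of unit vectors by convention.\<close>

definition positive_basis :: "'a::euclidean_space set \<Rightarrow> 'a set \<Rightarrow> bool" where
  "positive_basis S L \<longleftrightarrow>
     finite S \<and> subspace L \<and> (\<forall>d\<in>S. norm d = 1) \<and> positively_independent S \<and> pspan S = L"

definition minimal_positive_basis :: "'a::euclidean_space set \<Rightarrow> 'a set \<Rightarrow> bool" where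
  "minimal_positive_basis S L \<longleftrightarrow> positive_basis S L \<and> card S = dim L + 1"

definition sub_positive_basis :: "'a::euclidean_space set \<Rightarrow> 'a set \<Rightarrow> bool" where
  "sub_positive_basis S L \<longleftrightarrow>
     subspace L \<and> (\<exists>B. positive_basis B UNIV \<and> S \<subseteq> B) \<and> pspan S = L"

definition minimal_sub_positive_basis :: "'a::euclidean_space set \<Rightarrow> 'a set \<Rightarrow> bool" where
  "minimal_sub_positive_basis S L \<longleftrightarrow> sub_positive_basis S L \<and> card S = dim L + 1"

text \<open>
  The cosine measure computed in a subspace \<open>L\<close>. For finite nonempty \<open>S\<close> and \<open>L \<noteq> {0}\<close> the
  infimum is a minimum, see \<open>cosine_measure_in_attained\<close> below; the value is meaningless otherwise.
\<close>

definition cosine_measure_in :: "'a::euclidean_space set \<Rightarrow> 'a set \<Rightarrow> real" where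
  "cosine_measure_in L S = (INF u\<in>{u\<in>L. norm u = 1}. MAX d\<in>S. (u \<bullet> d) / norm d)"

abbreviation cosine_measure :: "'a::euclidean_space set \<Rightarrow> real" where
  "cosine_measure \<equiv> cosine_measure_in UNIV"

lemma continuous_on_Max_image:
  fixes f :: "'b \<Rightarrow> 'a::topological_space \<Rightarrow> real"
  assumes "finite S" "S \<noteq> {}" "\<And>d. d \<in> S \<Longrightarrow> continuous_on A (f d)"
  shows "continuous_on A (\<lambda>u. MAX d\<in>S. f d u)"
  using assms
proof (induction S rule: finite_ne_induct)
  case (singleton x)
  then show ?case by simp
next
  case (insert x F)
  then have "continuous_on A (\<lambda>u. max (f x u) (MAX d\<in>F. f d u))"
    by (intro continuous_on_max) auto
  with insert show ?case by simp
qed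

lemma cosine_measure_in_attained:
  fixes L :: "'a::euclidean_space set"
  assumes "finite S" "S \<noteq> {}" "subspace L" "L \<noteq> {0}"
  obtains u where "u \<in> L" "norm u = 1" "cosine_measure_in L S = (MAX d\<in>S. (u \<bullet> d) / norm d)"
    "\<And>v. v \<in> L \<Longrightarrow> norm v = 1 \<Longrightarrow> cosine_measure_in L S \<le> (MAX d\<in>S. (v \<bullet> d) / norm d)"
proof -
  let ?U = "{u\<in>L. norm u = 1}" and ?f = "\<lambda>u. MAX d\<in>S. (u \<bullet> d) / norm d"
  have eq: "?U = L \<inter> sphere 0 1" by auto
  have "compact ?U"
    unfolding eq by (intro closed_Int_compact closed_subspace assms compact_sphere)
  moreover have "?U \<noteq> {}"
  proof -
    have "0 \<in> L" using assms(3) by (rule subspace_0)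
    with assms(4) obtain x where "x \<in> L" "x \<noteq> 0" by auto
    then have "x /\<^sub>R norm x \<in> ?U"
      using assms(3) by (simp add: subspace_scale)
    then show ?thesis by auto
  qed
  moreover have "continuous_on ?U (\<lambda>u. (u \<bullet> d) / norm d)" for d
    unfolding divide_inverse
    by (intro continuous_on_mult_right continuous_on_inner continuous_on_id continuous_on_const)
  then have "continuous_on ?U ?f"
    by (rule continuous_on_Max_image[OF assms(1,2)])
  ultimately have "\<exists>u\<in>?U. \<forall>v\<in>?U. ?f u \<le> ?f v"
    by (rule continuous_attains_inf)
  then obtain u where u: "u \<in> ?U" "\<And>v. v \<in> ?U \<Longrightarrow> ?f u \<le> ?f v"
    by auto
  then have "cosine_measure_in L S = ?f u"
    unfolding cosine_measure_in_def by (intro cInf_eq_minimum) auto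
  with u that show thesis by auto
qed

definition optimal_over :: "'a::euclidean_space set set \<Rightarrow> 'a set \<Rightarrow> bool" where
  "optimal_over \<P> D \<longleftrightarrow> \<P> \<noteq> {} \<and> positive_basis D UNIV \<and>
     (\<forall>D'\<in>\<P>. positive_basis D' UNIV \<and> card D' = card D \<longrightarrow> cosine_measure D \<ge> cosine_measure D')"

definition optimal_minimal_sub_positive_basis :: "'a::euclidean_space set \<Rightarrow> 'a set \<Rightarrow> bool" where
  "optimal_minimal_sub_positive_basis S L \<longleftrightarrow> minimal_sub_positive_basis S L \<and>
     (\<forall>B. minimal_positive_basis B L \<longrightarrow> cosine_measure_in L S \<ge> cosine_measure_in L B)"

text \<open>
  \<open>V\<close> is the internal direct sum of the \<open>L i\<close>: every vector of \<open>V\<close> is \<open>\<Sum>i\<in>I. x i\<close> for exactly one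
  family with \<open>x i \<in> L i\<close>, and all such sums lie in \<open>V\<close>.
\<close>

definition is_direct_sum :: "'i set \<Rightarrow> ('i \<Rightarrow> 'a::real_vector set) \<Rightarrow> 'a set \<Rightarrow> bool" where
  "is_direct_sum I L V \<longleftrightarrow> bij_betw (\<lambda>x. \<Sum>i\<in>I. x i) (Pi\<^sub>E I L) V"

definition Omega_partition ::
    "nat \<Rightarrow> (real^'n) set \<Rightarrow> (nat \<Rightarrow> (real^'n) set) \<Rightarrow> (nat \<Rightarrow> (real^'n) set) \<Rightarrow> bool" where
  "Omega_partition s D P L \<longleftrightarrow> (let I = {1..s - CARD('n)} in
     D = (\<Union>i\<in>I. P i) \<and> disjoint_family_on P I \<and>
     (\<forall>i\<in>I. minimal_sub_positive_basis (P i) (L i) \<and> 1 \<le> dim (L i) \<and> dim (L i) \<le> CARD('n)) \<and>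
     is_direct_sum I L UNIV \<and>
     (\<forall>i\<in>I. \<forall>j\<in>I. i \<noteq> j \<longrightarrow> L i \<inter> L j = {0}))"

definition pairwise_orthogonal_parts :: "'i set \<Rightarrow> ('i \<Rightarrow> 'a::real_inner set) \<Rightarrow> bool" where
  "pairwise_orthogonal_parts I P \<longleftrightarrow>
     (\<forall>i\<in>I. \<forall>j\<in>I. i \<noteq> j \<longrightarrow> (\<forall>x\<in>P i. \<forall>y\<in>P j. x \<bullet> y = 0))"

definition Omega :: "nat \<Rightarrow> (real^'n) set set" where
  "Omega s = {D. positive_basis D UNIV \<and> card D = s \<and> (\<exists>P L. Omega_partition s D P L)}"

definition Omega_plus :: "nat \<Rightarrow> (real^'n) set set" where
  "Omega_plus s = {D \<in> Omega s. \<exists>P L. Omega_partition s D P L \<and>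
     pairwise_orthogonal_parts {1..s - CARD('n)} P}"

end

theory Submission
  imports Defs
begin

text \<open>
  The cosine measure of an orthogonal union of minimal positive bases is governed by the quantity
  \<open>\<Sum>i. (dim (L i))\<^sup>2\<close>: every member of \<open>\<Omega>\<^sup>+\<close> with subspaces \<open>L i\<close> has cosine measure at most
  \<open>1 / sqrt (\<Sum>i. (dim (L i))\<^sup>2)\<close>, and this value is reached when all parts are optimal. The
  dimensions sum to \<open>n\<close>, and among the tuples of \<open>s - n\<close> natural numbers with sum \<open>n\<close> a balanced one
  minimises the sum of squares (\<open>balanced_sum_squares_le\<close>).

  For a single part of dimension \<open>m\<close> the best value is \<open>1 / m\<close>. It cannot be exceeded, because the
  \<open>m + 1\<close> vectors satisfy a dependence with positive coefficients: the vector that has inner product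
  \<open>1\<close> with all of them except one of smallest coefficient has norm at least \<open>m\<close>
  (\<open>minimal_positive_spanning_inner_bound\<close>). It is reached by the vertices of a regular simplex
  (\<open>optimal_simplex_exists\<close>), so optimality of a part means that its cosine measure is at least \<open>1 / m\<close>.

  Parts combine by orthogonality, in the same way for both bounds. If \<open>u i\<close> is a unit vector of \<open>L i\<close>
  whose inner products with the \<open>i\<close>-th part are at most \<open>1 / m\<^sub>i\<close>, then the normalised combination of
  the \<open>u i\<close> with weights \<open>m\<^sub>i\<close> equalises these bounds (\<open>orthogonal_union_inner_bound\<close>). Conversely, a
  unit vector with components \<open>x i\<close> in the \<open>L i\<close> cannot have \<open>norm (x i) < m\<^sub>i / sqrt (\<Sum>j. m\<^sub>j\<^sup>2)\<close> for
  all \<open>i\<close>, by Pythagoras, and one large component suffices (\<open>orthogonal_union_inner_witness\<close>).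
\<close>

section \<open>Cosine measures through inner products\<close>

lemma cosine_measure_in_le:
  fixes L :: "'a::euclidean_space set"
  assumes S: "finite S" "S \<noteq> {}" "\<And>d. d \<in> S \<Longrightarrow> norm d = 1" and L: "subspace L"
    and u: "u \<in> L" "norm u = 1" "\<And>d. d \<in> S \<Longrightarrow> u \<bullet> d \<le> c"
  shows "cosine_measure_in L S \<le> c"
proof -
  have "L \<noteq> {0}" using u(1,2) by auto
  then have "cosine_measure_in L S \<le> (MAX d\<in>S. (u \<bullet> d) / norm d)"
    by (metis cosine_measure_in_attained[OF S(1,2) L] u(1,2))
  also have "\<dots> \<le> c"
    using S u(3) by (intro Max.boundedI) auto
  finally show ?thesis .
qed

lemma le_cosine_measure_in:
  fixes L :: "'a::euclidean_space set"
  assumes S: "finite S" "S \<noteq> {}" "\<And>d. d \<in> S \<Longrightarrow> norm d = 1" and L: "subspace L" "L \<noteq> {0}"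
    and c: "\<And>u. u \<in> L \<Longrightarrow> norm u = 1 \<Longrightarrow> \<exists>d\<in>S. c \<le> u \<bullet> d"
  shows "c \<le> cosine_measure_in L S"
proof -
  obtain u where u: "u \<in> L" "norm u = 1" "cosine_measure_in L S = (MAX d\<in>S. (u \<bullet> d) / norm d)"
    using cosine_measure_in_attained[OF S(1,2) L] by metis
  obtain d where d: "d \<in> S" "c \<le> u \<bullet> d" using c[OF u(1,2)] by blast
  have "(u \<bullet> d) / norm d \<le> (MAX d\<in>S. (u \<bullet> d) / norm d)"
    using S(1) d(1) by (intro Max_ge) auto
  with u(3) d S(3) show ?thesis by simp
qed

text \<open>
  The homogeneous form, for vectors of any norm, is what the components of a unit vector in a direct
  sum require.
\<close>

lemma cosine_measure_in_leD:
  fixes L :: "'a::euclidean_space set"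
  assumes S: "finite S" "S \<noteq> {}" "\<And>d. d \<in> S \<Longrightarrow> norm d = 1" and L: "subspace L"
    and c: "c \<le> cosine_measure_in L S" and v: "v \<in> L"
  shows "\<exists>d\<in>S. c * norm v \<le> v \<bullet> d"
proof (cases "v = 0")
  case True
  with S(2) show ?thesis by auto
next
  case False
  define u where "u = v /\<^sub>R norm v"
  have u: "u \<in> L" "norm u = 1"
    using False v L by (auto simp: u_def subspace_scale)
  show ?thesis
  proof (rule ccontr)
    assume *: "\<not> ?thesis"
    have "cosine_measure_in L S \<le> (MAX d\<in>S. u \<bullet> d)"
      using S by (intro cosine_measure_in_le[OF S L u]) auto
    also have "\<dots> < c"
    proof (subst Max_less_iff)
      show "\<forall>a\<in>(\<bullet>) u ` S. a < c"
        using * False by (auto simp: u_def field_simps not_le)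
    qed (use S in auto)
    finally show False using c by simp
  qed
qed

section \<open>No minimal positive spanning set beats the regular simplex\<close>

lemma pspan_subset_span: "pspan S \<subseteq> span S"
  by (auto simp: pspan_def intro!: span_sum intro: span_scale span_base)

lemma subset_pspan: "finite S \<Longrightarrow> S \<subseteq> pspan S"
proof
  fix x assume "finite S" "x \<in> S"
  then have "x = (\<Sum>d\<in>S. (if d = x then 1 else 0) *\<^sub>R d)"
    by (simp add: if_distrib[of "\<lambda>r. r *\<^sub>R _"] sum.delta cong: if_cong)
  then show "x \<in> pspan S"
    unfolding pspan_def by (intro CollectI exI[of _ "\<lambda>d. if d = x then 1 else 0"]) auto
qed

lemma span_eq_pspan:
  assumes "finite S" "subspace L" "pspan S = L"
  shows "span S = L"
proof
  show "span S \<subseteq> L"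
    using assms subset_pspan[of S] by (metis span_minimal)
  show "L \<subseteq> span S" using assms pspan_subset_span by auto
qed

text \<open>
  The vector \<open>- \<Sum>S\<close> lies in the positive span as well; adding one copy of each element of \<open>S\<close> to
  such a representation makes all coefficients strictly positive.
\<close>

lemma positive_dependence_exists:
  assumes "finite S" "subspace L" "pspan S = L"
  obtains l where "\<And>d. d \<in> S \<Longrightarrow> (0::real) < l d" "(\<Sum>d\<in>S. l d *\<^sub>R d) = 0"
proof -
  have "- (\<Sum>d\<in>S. d) \<in> L"
    using assms subset_pspan[of S] by (intro subspace_neg subspace_sum) auto
  then obtain c where c: "\<forall>d\<in>S. 0 \<le> c d" "- (\<Sum>d\<in>S. d) = (\<Sum>d\<in>S. c d *\<^sub>R d)"
    using assms(3) by (auto simp: pspan_def)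
  have "(\<Sum>d\<in>S. (1 + c d) *\<^sub>R d) = 0"
    by (simp add: scaleR_add_left sum.distrib flip: c(2))
  moreover have "0 < 1 + c d" if "d \<in> S" for d
    using c(1) that by (simp add: add_pos_nonneg)
  ultimately show thesis by (rule that[rotated])
qed

text \<open>
  A linear functional that is \<open>1\<close> on the independent set is represented by a vector of the whole
  space; its orthogonal projection to the span has the same inner products with \<open>B\<close>.
\<close>

lemma independent_inner_eq_one_exists:
  fixes B :: "'a::euclidean_space set"
  assumes "independent B"
  obtains v where "v \<in> span B" "\<And>b. b \<in> B \<Longrightarrow> v \<bullet> b = 1"
proof -
  obtain f :: "'a \<Rightarrow> real" where f: "linear f" "\<forall>b\<in>B. f b = 1"
    using linear_independent_extend[OF assms, of "\<lambda>_. 1"] by blast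
  obtain y z where yz: "y \<in> span B" "\<And>w. w \<in> span B \<Longrightarrow> orthogonal z w"
      "adjoint f 1 = y + z"
    using orthogonal_subspace_decomp_exists[of B "adjoint f 1"] by metis
  have "y \<bullet> b = 1" if b: "b \<in> B" for b
  proof -
    have "1 = b \<bullet> adjoint f 1"
      using adjoint_works[OF f(1), of b 1] f(2) b by simp
    also have "\<dots> = y \<bullet> b"
      using yz(2)[of b] b by (simp add: yz(3) inner_add_right orthogonal_def inner_commute span_base)
    finally show ?thesis by simp
  qed
  with yz(1) show thesis by (rule that)
qed

text \<open>
  Let \<open>e\<close> have the smallest coefficient \<open>l e\<close> in a positive dependence of \<open>S\<close>. The other vectors
  form a basis of \<open>L\<close>, so some \<open>v \<in> L\<close> has inner product \<open>1\<close> with each of them. The dependence then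
  gives \<open>v \<bullet> e = - (\<Sum>d\<in>S - {e}. l d) / l e \<le> - dim L\<close>, hence \<open>norm v \<ge> dim L\<close>, and normalising \<open>v\<close>
  gives the bound.
\<close>

lemma minimal_positive_spanning_inner_bound:
  fixes L :: "'a::euclidean_space set"
  assumes S: "finite S" "\<And>d. d \<in> S \<Longrightarrow> norm d = 1" and L: "subspace L"
    and span: "pspan S = L" and card: "card S = dim L + 1" and dim: "1 \<le> dim L"
  obtains u where "u \<in> L" "norm u = 1" "\<And>d. d \<in> S \<Longrightarrow> u \<bullet> d \<le> 1 / real (dim L)"
proof -
  obtain l where l: "\<And>d. d \<in> S \<Longrightarrow> (0::real) < l d" "(\<Sum>d\<in>S. l d *\<^sub>R d) = 0"
    using positive_dependence_exists[OF S(1) L span] by blast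
  have "S \<noteq> {}" using card by auto
  then have "Min (l ` S) \<in> l ` S" using S(1) by (intro Min_in) auto
  then obtain e where e: "e \<in> S" and Min_e: "Min (l ` S) = l e" by auto
  have e_le: "l e \<le> l d" if "d \<in> S" for d
    using S(1) that by (simp flip: Min_e)
  let ?B = "S - {e}"
  have le: "(\<Sum>d\<in>?B. l d *\<^sub>R d) = - l e *\<^sub>R e"
    using l(2) S(1) e by (simp add: sum.remove add_eq_0_iff)
  have e_span: "e \<in> span ?B"
  proof -
    have "e = (- 1 / l e) *\<^sub>R (\<Sum>d\<in>?B. l d *\<^sub>R d)"
      using l(1)[OF e] by (simp add: le)
    also have "\<dots> \<in> span ?B" by (intro span_scale span_sum span_base)
    finally show ?thesis .
  qed
  then have "span ?B = span S"
    using e by (metis insert_Diff span_redundant)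
  then have spanB: "span ?B = L" using span_eq_pspan[OF S(1) L span] by simp
  have cardB: "card ?B = dim L" using card e S(1) by simp
  have "independent ?B"
    using card_le_dim_spanning[of ?B L] spanB cardB S(1) L span_superset[of ?B] by auto
  then obtain v where v: "v \<in> L" "\<And>d. d \<in> ?B \<Longrightarrow> v \<bullet> d = 1"
    using independent_inner_eq_one_exists spanB by metis
  have ve: "l e * (v \<bullet> e) = - (\<Sum>d\<in>?B. l d)"
  proof -
    have "(\<Sum>d\<in>?B. l d) = v \<bullet> (\<Sum>d\<in>?B. l d *\<^sub>R d)"
      unfolding inner_sum_right by (intro sum.cong) (auto simp: v(2))
    then show ?thesis by (simp add: le)
  qed
  have "real (dim L) * l e \<le> (\<Sum>d\<in>?B. l d)"
    using sum_bounded_below[of ?B "l e" l] e_le cardB by simp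
  then have "l e * real (dim L) \<le> l e * - (v \<bullet> e)" using ve by (simp add: mult.commute)
  then have ve_le: "real (dim L) \<le> - (v \<bullet> e)"
    using l(1)[OF e] by (subst (asm) mult_le_cancel_left_pos) auto
  also have "\<dots> \<le> norm v"
    using Cauchy_Schwarz_ineq2[of v e] S(2)[OF e] by simp
  finally have nv: "real (dim L) \<le> norm v" .
  have pos: "0 < real (dim L)" using dim by simp
  with nv have v_pos: "0 < norm v" by linarith
  show thesis
  proof (rule that[of "v /\<^sub>R norm v"])
    show "v /\<^sub>R norm v \<in> L" using L v(1) by (simp add: subspace_scale)
    show "norm (v /\<^sub>R norm v) = 1" using v_pos by simp
    fix d assume d: "d \<in> S"
    have "v \<bullet> d \<le> 1" using v(2)[of d] d ve_le pos by (cases "d = e") auto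
    then have "(v /\<^sub>R norm v) \<bullet> d \<le> 1 / norm v"
      using v_pos by (simp add: field_simps)
    also have "\<dots> \<le> 1 / real (dim L)" using nv pos by (intro frac_le) auto
    finally show "(v /\<^sub>R norm v) \<bullet> d \<le> 1 / real (dim L)" .
  qed
qed

section \<open>The regular simplex\<close>

text \<open>
  With \<open>w\<close> the sum of an orthonormal basis \<open>B\<close> of \<open>L\<close>, one vertex of the simplex points along \<open>- w\<close>
  and the others are \<open>a b + c w\<close> for \<open>b \<in> B\<close>. The last conclusion says that the vertices form a
  tight frame; it expresses each vector of \<open>L\<close> by the vertices without a change of basis.
\<close>

lemma regular_simplex_exists:
  fixes L :: "'a::euclidean_space set"
  assumes L: "subspace L" and dim: "1 \<le> dim L"
  obtains S where "finite S" "S \<subseteq> L" "card S = dim L + 1" "\<And>d. d \<in> S \<Longrightarrow> norm d = 1"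
    "\<And>d e. d \<in> S \<Longrightarrow> e \<in> S \<Longrightarrow> d \<noteq> e \<Longrightarrow> d \<bullet> e = - 1 / real (dim L)"
    "\<Sum>S = 0"
    "\<And>x. x \<in> L \<Longrightarrow> (\<Sum>d\<in>S. (x \<bullet> d) *\<^sub>R d) = (1 + 1 / real (dim L)) *\<^sub>R x"
proof -
  obtain B where B: "B \<subseteq> L" "pairwise orthogonal B" "\<And>x. x \<in> B \<Longrightarrow> norm x = 1"
      "independent B" "card B = dim L" "span B = L"
    using orthonormal_basis_subspace[OF L] by metis
  have finB: "finite B" using B(4) by (rule independent_imp_finite)
  define m where "m = real (dim L)"
  have m: "m > 0" using dim by (simp add: m_def)
  have sm: "sqrt m > 0" "sqrt m * sqrt m = m" using m by auto
  define w where "w = \<Sum>B"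
  define a where "a = sqrt (1 + 1 / m)"
  define r where "r = 1 / sqrt m"
  \<comment> \<open>Here \<open>a\<close> and \<open>c\<close> solve the two conditions \<open>a + c m = 1 / sqrt m\<close>, which makes the vertices sum
    to zero, and \<open>2 a c + c\<^sup>2 m = - 1 / m\<close>, which gives the angles.\<close>
  define c where "c = (r - a) / m"
  define v where "v b = a *\<^sub>R b + c *\<^sub>R w" for b
  define v0 where "v0 = - r *\<^sub>R w"
  have a2: "a * a = 1 + 1 / m" using m by (simp add: a_def)
  have rr: "r * r = 1 / m" using sm by (simp add: r_def)
  have acm: "a + c * m = r" using m by (simp add: c_def)
  have quad: "2 * a * c + c * c * m = - 1 / m"
  proof -
    have "2 * a * c + c * c * m = c * (a + (a + c * m))" by (simp add: algebra_simps)
    also have "\<dots> = (r * r - a * a) / m"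
      unfolding acm using m by (simp add: c_def field_simps)
    also have "\<dots> = - 1 / m" by (simp add: a2 rr)
    finally show ?thesis .
  qed
  have bb: "b \<bullet> b' = (if b = b' then 1 else 0)" if "b \<in> B" "b' \<in> B" for b b'
    using B(2,3) that by (auto simp: pairwise_def orthogonal_def norm_eq_1)
  have wb: "w \<bullet> b = 1" if "b \<in> B" for b
    using that finB by (simp add: w_def inner_sum_left bb sum.delta cong: sum.cong)
  then have bw: "b \<bullet> w = 1" if "b \<in> B" for b using that by (simp add: inner_commute)
  have ww: "w \<bullet> w = m"
  proof -
    have "w \<bullet> w = (\<Sum>b\<in>B. w \<bullet> b)" by (subst (2) w_def) (simp add: inner_sum_right)
    then show ?thesis using wb B(5) by (simp add: m_def)
  qed
  have vv: "v b \<bullet> v b' = (if b = b' then 1 else - 1 / m)" if "b \<in> B" "b' \<in> B" for b b'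
  proof -
    have "v b \<bullet> v b' = a * a * (b \<bullet> b') + (2 * a * c + c * c * m)"
      using that by (simp add: v_def inner_add_left inner_add_right wb bw ww algebra_simps)
    then show ?thesis using quad a2 bb[OF that] by auto
  qed
  have v0v: "v0 \<bullet> v b = - 1 / m" if "b \<in> B" for b
  proof -
    have "v0 \<bullet> v b = - r * (a + c * m)"
      using that by (simp add: v_def v0_def inner_add_right wb ww algebra_simps)
    then show ?thesis by (simp add: acm rr)
  qed
  have v00: "v0 \<bullet> v0 = 1"
    using m rr by (simp add: v0_def ww flip: mult.assoc)
  have inj: "inj_on v B"
  proof (rule inj_onI)
    fix x y assume "x \<in> B" "y \<in> B" "v x = v y"
    then have "v x \<bullet> v y = 1" using vv[of x x] by simp
    then show "x = y"
      using vv[of x y] m \<open>x \<in> B\<close> \<open>y \<in> B\<close> by (auto split: if_splits simp: field_simps)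
  qed
  have v0_notin: "v0 \<notin> v ` B"
  proof
    assume "v0 \<in> v ` B"
    then obtain b where "b \<in> B" "v0 = v b" by auto
    then have "1 = - 1 / m" using v00 v0v[of b] by simp
    then show False using m by (simp add: field_simps)
  qed
  define S where "S = insert v0 (v ` B)"
  have sumS: "(\<Sum>d\<in>S. g d) = g v0 + (\<Sum>b\<in>B. g (v b))" for g :: "'a \<Rightarrow> 'a"
    using finB v0_notin by (simp add: S_def sum.reindex[OF inj])
  have wL: "w \<in> L" unfolding w_def using L B(1) by (intro subspace_sum) auto
  show thesis
  proof (rule that[of S])
    show "finite S" using finB by (simp add: S_def)
    show "S \<subseteq> L"
      using L B(1) wL by (auto simp: S_def v_def v0_def intro!: subspace_add subspace_scale subspace_neg)
    show "card S = dim L + 1"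
      using finB v0_notin B(5) by (simp add: S_def card_image[OF inj])
    show "norm d = 1" if "d \<in> S" for d
      using that v00 vv by (auto simp: S_def norm_eq_1)
    show "d \<bullet> e = - 1 / real (dim L)" if "d \<in> S" "e \<in> S" "d \<noteq> e" for d e
      using that v0v vv v0v[unfolded inner_commute[of v0]] by (auto simp: S_def m_def)
    have "\<Sum>S = (- r + a + c * m) *\<^sub>R w"
      using B(5) sumS[of "\<lambda>x. x"]
      by (simp add: v_def v0_def sum.distrib scaleR_add_left m_def mult.commute
          sum_constant_scaleR scaleR_diff_left
          flip: scaleR_sum_right w_def)
    then show "\<Sum>S = 0" using acm by (simp add: add.assoc)
    fix x assume x: "x \<in> L"
    have ex: "(\<Sum>b\<in>B. (x \<bullet> b) *\<^sub>R b) = x"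
      using orthonormal_basis_expand[of B x] B x finB by auto
    have xw: "(\<Sum>b\<in>B. x \<bullet> b) = x \<bullet> w" by (simp add: w_def inner_sum_right)
    have "(\<Sum>b\<in>B. (x \<bullet> v b) *\<^sub>R v b)
        = (\<Sum>b\<in>B. (a * a) *\<^sub>R ((x \<bullet> b) *\<^sub>R b) + (a * c * (x \<bullet> w)) *\<^sub>R b
            + (a * c * (x \<bullet> b)) *\<^sub>R w + (c * c * (x \<bullet> w)) *\<^sub>R w)"
      by (intro sum.cong) (auto simp: v_def inner_add_right algebra_simps)
    also have "\<dots> = (a * a) *\<^sub>R x + (a * c * (x \<bullet> w)) *\<^sub>R w
        + (a * c * (x \<bullet> w)) *\<^sub>R w + (m * (c * c * (x \<bullet> w))) *\<^sub>R w"
      unfolding sum.distrib scaleR_sum_right[symmetric] scaleR_sum_left[symmetric]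
        sum_distrib_left[symmetric] ex xw w_def[symmetric] sum_constant_scaleR B(5)
      by (simp add: m_def ac_simps)
    also have "\<dots> = (a * a) *\<^sub>R x + ((2 * a * c + c * c * m) * (x \<bullet> w)) *\<^sub>R w"
      by (simp add: algebra_simps flip: scaleR_add_left)
    finally have "(\<Sum>b\<in>B. (x \<bullet> v b) *\<^sub>R v b) = (a * a) *\<^sub>R x - ((x \<bullet> w) / m) *\<^sub>R w"
      unfolding quad by simp
    moreover have "(x \<bullet> v0) *\<^sub>R v0 = ((r * r) * (x \<bullet> w)) *\<^sub>R w"
      by (simp add: v0_def ac_simps)
    ultimately show "(\<Sum>d\<in>S. (x \<bullet> d) *\<^sub>R d) = (1 + 1 / real (dim L)) *\<^sub>R x"
      unfolding sumS rr by (simp add: a2 m_def)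
  qed
qed

text \<open>
  Distinct vertices have negative inner product, which rules out that a vertex is a nonnegative
  combination of the others. For the cosine measure, let \<open>t\<close> be the largest inner product of a unit vector \<open>u\<close> with a vertex. These
  inner products lie in \<open>[- 1, t]\<close>, have sum \<open>0\<close>, and have sum of squares \<open>1 + 1 / m\<close> by the frame
  identity, which is too much to fit in when \<open>t < 1 / m\<close>: summing \<open>(t - u \<bullet> d) * (u \<bullet> d + 1) \<ge> 0\<close>
  over the vertices gives \<open>(m + 1) * t \<ge> 1 + 1 / m\<close>.
\<close>

lemma optimal_simplex_exists:
  fixes L :: "'a::euclidean_space set"
  assumes L: "subspace L" and dim: "1 \<le> dim L"
  obtains S where "minimal_positive_basis S L" "1 / real (dim L) \<le> cosine_measure_in L S"
proof -
  obtain S where S: "finite S" "S \<subseteq> L" "card S = dim L + 1" "\<And>d. d \<in> S \<Longrightarrow> norm d = 1"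
    and angle: "\<And>d e. d \<in> S \<Longrightarrow> e \<in> S \<Longrightarrow> d \<noteq> e \<Longrightarrow> d \<bullet> e = - 1 / real (dim L)"
    and sum0: "\<Sum>S = 0"
    and frame: "\<And>x. x \<in> L \<Longrightarrow> (\<Sum>d\<in>S. (x \<bullet> d) *\<^sub>R d) = (1 + 1 / real (dim L)) *\<^sub>R x"
    by (rule regular_simplex_exists[OF L dim], rule that)
  define m where "m = real (dim L)"
  have m: "m > 0" using dim by (simp add: m_def)
  note frame' = frame[folded m_def]
  have S_ne: "S \<noteq> {}" using S(3) by auto
  have "positively_independent S"
    unfolding positively_independent_def
  proof (intro ballI notI)
    fix d assume d: "d \<in> S" "d \<in> pspan (S - {d})"
    then obtain k where k: "d = (\<Sum>e\<in>S - {d}. k e *\<^sub>R e)" "\<forall>e\<in>S - {d}. 0 \<le> k e"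
      by (auto simp: pspan_def)
    have "d \<bullet> d = (\<Sum>e\<in>S - {d}. k e * (d \<bullet> e))"
      by (subst (2) k(1)) (simp add: inner_sum_right)
    also have "\<dots> \<le> 0"
    proof (intro sum_nonpos mult_nonneg_nonpos)
      fix e assume e: "e \<in> S - {d}"
      show "0 \<le> k e" using k(2) e by auto
      show "d \<bullet> e \<le> 0" using angle[of d e] d(1) e by auto
    qed
    finally show False using S(4)[OF d(1)] by (simp add: norm_eq_1)
  qed
  moreover have "pspan S = L"
  proof
    show "pspan S \<subseteq> L"
      using S(2) L by (auto simp: pspan_def intro!: subspace_sum subspace_scale)
    show "L \<subseteq> pspan S"
    proof
      fix x assume x: "x \<in> L"
      \<comment> \<open>Since \<open>\<Sum>S = 0\<close>, the frame coefficients may all be raised by the same constant; \<open>norm x\<close>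
        makes them nonnegative by Cauchy-Schwarz.\<close>
      let ?k = "\<lambda>d. (x \<bullet> d + norm x) / (1 + 1 / m)"
      have pos: "1 + 1 / m \<noteq> 0" using m by (simp add: add_pos_pos less_imp_neq[symmetric])
      have "(\<Sum>d\<in>S. ?k d *\<^sub>R d)
          = (1 / (1 + 1 / m)) *\<^sub>R ((\<Sum>d\<in>S. (x \<bullet> d) *\<^sub>R d) + norm x *\<^sub>R \<Sum>S)"
        by (simp add: scaleR_sum_right scaleR_add_left scaleR_add_right sum.distrib
            add_divide_distrib)
      also have "\<dots> = x" using frame'[OF x] pos by (simp add: sum0)
      finally have "x = (\<Sum>d\<in>S. ?k d *\<^sub>R d)" by simp
      moreover have "0 \<le> ?k d" if "d \<in> S" for d
        using Cauchy_Schwarz_ineq2[of x d] S(4)[OF that] m by auto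
      ultimately show "x \<in> pspan S" unfolding pspan_def by (intro CollectI exI[of _ ?k]) simp
    qed
  qed
  ultimately have mpb: "minimal_positive_basis S L"
    using S L by (auto simp: minimal_positive_basis_def positive_basis_def)
  have "1 / m \<le> cosine_measure_in L S"
  proof (rule le_cosine_measure_in[OF S(1) S_ne S(4) L])
    show "L \<noteq> {0}" using dim by auto
    fix u assume u: "u \<in> L" "norm u = 1"
    have sum_inner: "(\<Sum>d\<in>S. u \<bullet> d) = 0"
      using sum0 by (simp flip: inner_sum_right)
    have "(\<Sum>d\<in>S. (u \<bullet> d) * (u \<bullet> d)) = u \<bullet> (\<Sum>d\<in>S. (u \<bullet> d) *\<^sub>R d)"
      by (simp add: inner_sum_right)
    also have "\<dots> = 1 + 1 / m" using frame[OF u(1)] u(2) by (simp add: m_def norm_eq_1)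
    finally have sum_sq: "(\<Sum>d\<in>S. (u \<bullet> d) * (u \<bullet> d)) = 1 + 1 / m" .
    define t where "t = (MAX d\<in>S. u \<bullet> d)"
    have "0 \<le> (\<Sum>d\<in>S. (t - u \<bullet> d) * (u \<bullet> d + 1))"
    proof (intro sum_nonneg mult_nonneg_nonneg)
      fix d assume d: "d \<in> S"
      show "0 \<le> t - u \<bullet> d" using S(1) d by (simp add: t_def)
      show "0 \<le> u \<bullet> d + 1" using Cauchy_Schwarz_ineq2[of u d] u(2) S(4)[OF d] by auto
    qed
    also have "\<dots> = (t - 1) * (\<Sum>d\<in>S. u \<bullet> d) + t * real (card S) - (\<Sum>d\<in>S. (u \<bullet> d) * (u \<bullet> d))"
      by (simp add: algebra_simps sum.distrib sum_subtractf sum_distrib_left)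
    also have "\<dots> = t * (m + 1) - (1 + 1 / m)"
      using sum_inner sum_sq S(3) by (simp add: m_def)
    also have "\<dots> = (t - 1 / m) * (m + 1)" using m by (simp add: field_simps)
    finally have "1 / m \<le> t" using m by (simp add: zero_le_mult_iff)
    moreover have "t \<in> (\<lambda>d. u \<bullet> d) ` S"
      unfolding t_def using S(1) S_ne by (intro Max_in) auto
    ultimately show "\<exists>d\<in>S. 1 / m \<le> u \<bullet> d" by auto
  qed
  with mpb show thesis by (intro that) (auto simp: m_def)
qed

section \<open>Orthogonal unions\<close>

lemma orthogonal_pspans:
  assumes "\<And>x y. x \<in> S \<Longrightarrow> y \<in> T \<Longrightarrow> x \<bullet> y = 0" "x \<in> pspan S" "y \<in> pspan T"
  shows "x \<bullet> y = 0"
  using assms by (auto simp: pspan_def inner_sum_left inner_sum_right intro!: sum.neutral)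

text \<open>
  The weights \<open>r i\<close> in \<open>\<Sum>i. r i *\<^sub>R u i\<close> cancel the bounds \<open>1 / r i\<close>: before normalisation every
  inner product is at most \<open>1\<close>, whichever part the vector \<open>d\<close> comes from.
\<close>

lemma orthogonal_union_inner_bound:
  fixes P L :: "'i \<Rightarrow> 'a::real_inner set" and r :: "'i \<Rightarrow> real"
  assumes I: "finite I" "I \<noteq> {}"
    and orth: "\<And>i j x y. i \<in> I \<Longrightarrow> j \<in> I \<Longrightarrow> i \<noteq> j \<Longrightarrow> x \<in> L i \<Longrightarrow> y \<in> L j \<Longrightarrow> x \<bullet> y = 0"
    and PL: "\<And>i. i \<in> I \<Longrightarrow> P i \<subseteq> L i" and r: "\<And>i. i \<in> I \<Longrightarrow> 0 < r i"
    and u: "\<And>i. i \<in> I \<Longrightarrow> u i \<in> L i" "\<And>i. i \<in> I \<Longrightarrow> norm (u i) = 1"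
      "\<And>i d. i \<in> I \<Longrightarrow> d \<in> P i \<Longrightarrow> u i \<bullet> d \<le> 1 / r i"
  shows "\<exists>v. norm v = 1 \<and> (\<forall>i\<in>I. \<forall>d\<in>P i. v \<bullet> d \<le> 1 / sqrt (\<Sum>i\<in>I. (r i)\<^sup>2))"
proof -
  define R where "R = sqrt (\<Sum>i\<in>I. (r i)\<^sup>2)"
  define w where "w = (\<Sum>i\<in>I. r i *\<^sub>R u i)"
  have "0 < (\<Sum>i\<in>I. (r i)\<^sup>2)" using I r by (intro sum_pos zero_less_power)
  then have R: "0 < R" by (simp add: R_def)
  have "(norm w)\<^sup>2 = (\<Sum>i\<in>I. (norm (r i *\<^sub>R u i))\<^sup>2)"
    unfolding w_def using I(1) orth u(1)
    by (intro norm_sum_Pythagorean) (auto simp: pairwise_def orthogonal_def)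
  also have "\<dots> = (\<Sum>i\<in>I. (r i)\<^sup>2)" using u(2) by (simp add: power_mult_distrib)
  finally have norm_w: "norm w = R" by (simp add: R_def real_sqrt_unique)
  have inner_w: "w \<bullet> d = r i * (u i \<bullet> d)" if "i \<in> I" "d \<in> P i" for i d
  proof -
    have "u j \<bullet> d = 0" if "j \<in> I" "j \<noteq> i" for j
      using orth[of j i] u(1) PL \<open>i \<in> I\<close> \<open>d \<in> P i\<close> that by blast
    then have "w \<bullet> d = (\<Sum>j\<in>I. if j = i then r i * (u i \<bullet> d) else 0)"
      unfolding w_def inner_sum_left by (intro sum.cong) auto
    then show ?thesis using I(1) that(1) by simp
  qed
  show ?thesis
  proof (intro exI[of _ "w /\<^sub>R R"] conjI ballI)
    show "norm (w /\<^sub>R R) = 1" using R norm_w by simp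
    fix i d assume i: "i \<in> I" "d \<in> P i"
    have "w \<bullet> d \<le> 1" using inner_w[OF i] u(3)[OF i] r[OF i(1)] by (simp add: field_simps)
    then show "(w /\<^sub>R R) \<bullet> d \<le> 1 / sqrt (\<Sum>i\<in>I. (r i)\<^sup>2)"
      unfolding R_def[symmetric] using R by (simp add: field_simps)
  qed
qed

text \<open>
  If all components were shorter than \<open>r i / sqrt (\<Sum>i. (r i)\<^sup>2)\<close>, the squares of their norms would
  sum to less than \<open>1\<close>. A component that is long enough is detected by its own part, and the other
  components do not contribute to that inner product.
\<close>

lemma orthogonal_union_inner_witness:
  fixes P L :: "'i \<Rightarrow> 'a::real_inner set" and r :: "'i \<Rightarrow> real"
  assumes I: "finite I" "I \<noteq> {}"
    and orth: "\<And>i j x y. i \<in> I \<Longrightarrow> j \<in> I \<Longrightarrow> i \<noteq> j \<Longrightarrow> x \<in> L i \<Longrightarrow> y \<in> L j \<Longrightarrow> x \<bullet> y = 0"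
    and PL: "\<And>i. i \<in> I \<Longrightarrow> P i \<subseteq> L i" and r: "\<And>i. i \<in> I \<Longrightarrow> 0 < r i"
    and part: "\<And>i x. i \<in> I \<Longrightarrow> x \<in> L i \<Longrightarrow> \<exists>d\<in>P i. 1 / r i * norm x \<le> x \<bullet> d"
    and x: "\<And>i. i \<in> I \<Longrightarrow> x i \<in> L i" "norm (\<Sum>i\<in>I. x i) = 1"
  shows "\<exists>i\<in>I. \<exists>d\<in>P i. 1 / sqrt (\<Sum>i\<in>I. (r i)\<^sup>2) \<le> (\<Sum>i\<in>I. x i) \<bullet> d"
proof -
  define R where "R = sqrt (\<Sum>i\<in>I. (r i)\<^sup>2)"
  have pos: "0 < (\<Sum>i\<in>I. (r i)\<^sup>2)" using I r by (intro sum_pos zero_less_power)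
  then have R: "0 < R" "R\<^sup>2 = (\<Sum>i\<in>I. (r i)\<^sup>2)" by (simp_all add: R_def)
  have pyth: "(\<Sum>i\<in>I. (norm (x i))\<^sup>2) = 1"
    using norm_sum_Pythagorean[of I x] I(1) orth x by (auto simp: pairwise_def orthogonal_def)
  have "\<exists>i\<in>I. r i / R \<le> norm (x i)"
  proof (rule ccontr)
    assume "\<not> ?thesis"
    then have "(\<Sum>i\<in>I. (norm (x i))\<^sup>2) < (\<Sum>i\<in>I. (r i / R)\<^sup>2)"
      using I by (intro sum_strict_mono power_strict_mono) (auto simp: not_le)
    also have "\<dots> = 1"
      using pos by (simp add: power_divide R(2) flip: sum_divide_distrib)
    finally show False using pyth by simp
  qed
  then obtain i where i: "i \<in> I" "r i / R \<le> norm (x i)" by blast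
  obtain d where d: "d \<in> P i" "1 / r i * norm (x i) \<le> x i \<bullet> d"
    using part[OF i(1) x(1)[OF i(1)]] by blast
  have other: "x j \<bullet> d = 0" if "j \<in> I" "j \<noteq> i" for j
    using orth[of j i] x(1) PL i(1) d(1) that by blast
  have "1 / R \<le> 1 / r i * norm (x i)" using i(2) r[OF i(1)] R(1) by (simp add: field_simps)
  also have "\<dots> \<le> x i \<bullet> d" by (rule d(2))
  also have "x i \<bullet> d = (\<Sum>j\<in>I. if j = i then x i \<bullet> d else 0)" using I(1) i(1) by simp
  also have "\<dots> = (\<Sum>i\<in>I. x i) \<bullet> d"
    unfolding inner_sum_left using other by (intro sum.cong) auto
  finally show ?thesis using i(1) d(1) by (auto simp: R_def)
qed

section \<open>Balanced dimensions\<close>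

text \<open>
  Every integer \<open>x\<close> satisfies \<open>(x - q) * (x - q - 1) \<ge> 0\<close>, with equality for \<open>x = q\<close> and \<open>x = q + 1\<close>.
  Thus \<open>x\<^sup>2 - (2 q + 1) x\<close> attains its minimum over the integers at these two points, and the linear
  term has the same sum for \<open>f\<close> and \<open>g\<close>.
\<close>

lemma balanced_sum_squares_le:
  fixes f g :: "'i \<Rightarrow> nat" and q :: nat
  assumes "\<And>i. i \<in> I \<Longrightarrow> f i = q \<or> f i = q + 1" and "sum f I = sum g I"
  shows "(\<Sum>i\<in>I. (real (f i))\<^sup>2) \<le> (\<Sum>i\<in>I. (real (g i))\<^sup>2)"
proof -
  let ?h = "\<lambda>x::real. x\<^sup>2 - (2 * real q + 1) * x"
  have "?h (real (f i)) \<le> ?h (real (g i))" if "i \<in> I" for i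
  proof -
    have "0 \<le> (int (g i) - int q) * (int (g i) - int q - 1)"
      by (cases "g i \<le> q") (auto intro: mult_nonpos_nonpos)
    then have "real_of_int 0 \<le> real_of_int ((int (g i) - int q) * (int (g i) - int q - 1))"
      by (subst of_int_le_iff)
    then show ?thesis
      using assms(1)[OF that] by (auto simp: power2_eq_square algebra_simps)
  qed
  then have "(\<Sum>i\<in>I. ?h (real (f i))) \<le> (\<Sum>i\<in>I. ?h (real (g i)))" by (rule sum_mono)
  moreover have "(\<Sum>i\<in>I. real (f i)) = (\<Sum>i\<in>I. real (g i))"
    using assms(2) by (metis of_nat_sum)
  ultimately show ?thesis by (simp add: sum_subtractf flip: sum_distrib_left)
qed

lemma floor_or_ceiling_of_nat_divide:
  fixes a :: nat
  assumes "int a = \<lfloor>real n / real k\<rfloor> \<or> int a = \<lceil>real n / real k\<rceil>"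
  shows "a = n div k \<or> a = n div k + 1"
proof -
  have "\<lfloor>real n / real k\<rfloor> = int (n div k)" by (rule floor_divide_of_nat_eq)
  moreover have "\<lceil>real n / real k\<rceil> = \<lfloor>real n / real k\<rfloor> \<or> \<lceil>real n / real k\<rceil> = \<lfloor>real n / real k\<rfloor> + 1"
    by (simp add: ceiling_altdef)
  ultimately show ?thesis using assms by linarith
qed

section \<open>Orthogonal partitions of a positive basis\<close>

text \<open>
  The sum of the dimensions comes from counting vectors: the parts are disjoint and the \<open>i\<close>-th one has
  \<open>dim (L i) + 1\<close> elements, so \<open>s = (\<Sum>i\<in>I. dim (L i)) + (s - CARD('n))\<close>. As the index set is nonempty,
  the subtraction here does not truncate.
\<close>

lemma orthogonal_Omega_partitionD:
  fixes D :: "(real^'n) set"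
  assumes D: "positive_basis D UNIV" "card D = s" and part: "Omega_partition s D P L"
    and orthP: "pairwise_orthogonal_parts {1..s - CARD('n)} P"
  defines "I \<equiv> {1..s - CARD('n)}"
  shows "I \<noteq> {}" "D = (\<Union>i\<in>I. P i)" "(\<Sum>i\<in>I. dim (L i)) = CARD('n)"
    "\<And>i. i \<in> I \<Longrightarrow> finite (P i)" "\<And>i. i \<in> I \<Longrightarrow> P i \<subseteq> L i" "\<And>i. i \<in> I \<Longrightarrow> subspace (L i)"
    "\<And>i. i \<in> I \<Longrightarrow> pspan (P i) = L i" "\<And>i. i \<in> I \<Longrightarrow> card (P i) = dim (L i) + 1"
    "\<And>i. i \<in> I \<Longrightarrow> 1 \<le> dim (L i)"
    "\<And>i j x y. i \<in> I \<Longrightarrow> j \<in> I \<Longrightarrow> i \<noteq> j \<Longrightarrow> x \<in> L i \<Longrightarrow> y \<in> L j \<Longrightarrow> x \<bullet> y = 0"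
    "\<And>u. \<exists>x. (\<forall>i\<in>I. x i \<in> L i) \<and> (\<Sum>i\<in>I. x i) = u"
proof -
  have unfolded: "D = (\<Union>i\<in>I. P i)" "disjoint_family_on P I"
      "\<And>i. i \<in> I \<Longrightarrow> minimal_sub_positive_basis (P i) (L i)"
      "\<And>i. i \<in> I \<Longrightarrow> 1 \<le> dim (L i)" "is_direct_sum I L UNIV"
    using part unfolding Omega_partition_def Let_def I_def[symmetric] by blast+
  show Deq: "D = (\<Union>i\<in>I. P i)" by (rule unfolded)
  have finD: "finite D" using D by (simp add: positive_basis_def)
  show finP: "finite (P i)" if "i \<in> I" for i
    using finite_subset[OF _ finD] Deq that by blast
  show sub: "subspace (L i)" and pspan: "pspan (P i) = L i"
    and card: "card (P i) = dim (L i) + 1" if "i \<in> I" for i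
    using unfolded(3)[OF that]
    by (auto simp: minimal_sub_positive_basis_def sub_positive_basis_def)
  show "1 \<le> dim (L i)" if "i \<in> I" for i using unfolded(4)[OF that] .
  show "P i \<subseteq> L i" if "i \<in> I" for i using subset_pspan[OF finP] pspan that by blast
  show "x \<bullet> y = 0" if "i \<in> I" "j \<in> I" "i \<noteq> j" "x \<in> L i" "y \<in> L j" for i j x y
  proof (rule orthogonal_pspans)
    show "x \<in> pspan (P i)" "y \<in> pspan (P j)" using that pspan by blast+
    show "a \<bullet> b = 0" if "a \<in> P i" "b \<in> P j" for a b
      using orthP that \<open>i \<in> I\<close> \<open>j \<in> I\<close> \<open>i \<noteq> j\<close>
      unfolding pairwise_orthogonal_parts_def I_def[symmetric] by blast
  qed
  show "\<exists>x. (\<forall>i\<in>I. x i \<in> L i) \<and> (\<Sum>i\<in>I. x i) = u" for u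
  proof -
    have "u \<in> (\<lambda>x. \<Sum>i\<in>I. x i) ` Pi\<^sub>E I L"
      using unfolded(5) by (simp add: is_direct_sum_def bij_betw_def)
    then show ?thesis by (auto simp: PiE_def)
  qed
  show ne: "I \<noteq> {}"
  proof
    assume "I = {}"
    then have "D = {}" using Deq by simp
    then have "(UNIV :: (real^'n) set) = {0}" using D by (simp add: positive_basis_def pspan_def)
    then show False by (simp add: UNIV_not_singleton)
  qed
  have "card D = (\<Sum>i\<in>I. card (P i))"
    unfolding Deq using finP unfolded(2)
    by (intro card_UN_disjoint) (auto simp: I_def disjoint_family_on_def)
  also have "\<dots> = (\<Sum>i\<in>I. dim (L i) + 1)"
    by (intro sum.cong refl card)
  also have "\<dots> = (\<Sum>i\<in>I. dim (L i)) + (s - CARD('n))"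
    unfolding sum.distrib by (simp add: I_def)
  finally show "(\<Sum>i\<in>I. dim (L i)) = CARD('n)" using D(2) ne by (auto simp: I_def)
qed

lemma orthogonal_Omega_partition_cosine_measure_le:
  fixes D :: "(real^'n) set"
  assumes D: "positive_basis D UNIV" "card D = s" and part: "Omega_partition s D P L"
    and orthP: "pairwise_orthogonal_parts {1..s - CARD('n)} P"
  shows "cosine_measure D \<le> 1 / sqrt (\<Sum>i\<in>{1..s - CARD('n)}. (real (dim (L i)))\<^sup>2)"
proof -
  define I where "I = {1..s - CARD('n)}"
  note p = orthogonal_Omega_partitionD[OF D part orthP, folded I_def]
  have D': "finite D" "\<And>d. d \<in> D \<Longrightarrow> norm d = 1" using D by (auto simp: positive_basis_def)
  have "\<exists>u. u \<in> L i \<and> norm u = 1 \<and> (\<forall>d\<in>P i. u \<bullet> d \<le> 1 / real (dim (L i)))"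
    if "i \<in> I" for i
  proof -
    have "norm d = 1" if "d \<in> P i" for d using D'(2) p(2) \<open>i \<in> I\<close> that by blast
    from minimal_positive_spanning_inner_bound[OF p(4)[OF that] this p(6)[OF that] p(7)[OF that]
        p(8)[OF that] p(9)[OF that]]
    show ?thesis by metis
  qed
  then obtain u where u: "\<And>i. i \<in> I \<Longrightarrow> u i \<in> L i" "\<And>i. i \<in> I \<Longrightarrow> norm (u i) = 1"
      "\<And>i d. i \<in> I \<Longrightarrow> d \<in> P i \<Longrightarrow> u i \<bullet> d \<le> 1 / real (dim (L i))"
    by metis
  have finI: "finite I" by (simp add: I_def)
  have pos: "0 < real (dim (L i))" if "i \<in> I" for i using p(9)[OF that] by simp
  have "\<exists>v. norm v = 1 \<and> (\<forall>i\<in>I. \<forall>d\<in>P i. v \<bullet> d \<le> 1 / sqrt (\<Sum>i\<in>I. (real (dim (L i)))\<^sup>2))"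
    by (rule orthogonal_union_inner_bound[of I L P _ u]; fact)
  then obtain v where v: "norm v = 1"
      "\<And>i d. i \<in> I \<Longrightarrow> d \<in> P i \<Longrightarrow> v \<bullet> d \<le> 1 / sqrt (\<Sum>i\<in>I. (real (dim (L i)))\<^sup>2)"
    by blast
  show ?thesis unfolding I_def[symmetric]
  proof (rule cosine_measure_in_le[OF D'(1) _ D'(2)])
    show "D \<noteq> {}"
    proof -
      obtain i where i: "i \<in> I" using p(1) by auto
      with p(8)[OF this] have "P i \<noteq> {}" by auto
      with i p(2) show ?thesis by auto
    qed
    show "v \<bullet> d \<le> 1 / sqrt (\<Sum>i\<in>I. (real (dim (L i)))\<^sup>2)" if "d \<in> D" for d
      using v(2) that p(2) by blast
  qed (use v in auto)
qed

text \<open>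
  Optimality of a part is a comparison with all minimal positive bases of \<open>L i\<close>; comparing with the
  regular simplex turns it into the numerical bound \<open>1 / dim (L i)\<close>.
\<close>

lemma optimal_parts_le_cosine_measure:
  fixes D :: "(real^'n) set"
  assumes D: "positive_basis D UNIV" "card D = s" and part: "Omega_partition s D P L"
    and orthP: "pairwise_orthogonal_parts {1..s - CARD('n)} P"
    and opt: "\<And>i. i \<in> {1..s - CARD('n)} \<Longrightarrow> optimal_minimal_sub_positive_basis (P i) (L i)"
  shows "1 / sqrt (\<Sum>i\<in>{1..s - CARD('n)}. (real (dim (L i)))\<^sup>2) \<le> cosine_measure D"
proof -
  define I where "I = {1..s - CARD('n)}"
  note p = orthogonal_Omega_partitionD[OF D part orthP, folded I_def]
  have D': "finite D" "\<And>d. d \<in> D \<Longrightarrow> norm d = 1" using D by (auto simp: positive_basis_def)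
  have P_ne: "P i \<noteq> {}" if "i \<in> I" for i using p(8)[OF that] by auto
  have part_witness: "\<exists>d\<in>P i. 1 / real (dim (L i)) * norm x \<le> x \<bullet> d"
    if i: "i \<in> I" and x: "x \<in> L i" for i x
  proof -
    obtain S where S: "minimal_positive_basis S (L i)"
        "1 / real (dim (L i)) \<le> cosine_measure_in (L i) S"
      using optimal_simplex_exists[OF p(6)[OF i] p(9)[OF i]] by blast
    have "cosine_measure_in (L i) S \<le> cosine_measure_in (L i) (P i)"
      using opt[folded I_def, OF i] S(1) by (simp add: optimal_minimal_sub_positive_basis_def)
    with S(2) have le: "1 / real (dim (L i)) \<le> cosine_measure_in (L i) (P i)" by linarith
    have "norm d = 1" if "d \<in> P i" for d using D'(2) p(2) i that by blast
    from cosine_measure_in_leD[OF p(4)[OF i] P_ne[OF i] this p(6)[OF i] le x] show ?thesis .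
  qed
  have finI: "finite I" by (simp add: I_def)
  have pos: "0 < real (dim (L i))" if "i \<in> I" for i using p(9)[OF that] by simp
  show ?thesis unfolding I_def[symmetric]
  proof (rule le_cosine_measure_in[OF D'(1) _ D'(2)])
    show "D \<noteq> {}" using p(1,2) P_ne by auto
    show "(UNIV :: (real^'n) set) \<noteq> {0}" by (rule UNIV_not_singleton)
    fix u :: "real^'n" assume u: "norm u = 1"
    obtain x where x: "\<forall>i\<in>I. x i \<in> L i" "(\<Sum>i\<in>I. x i) = u" using p(11) by blast
    have "\<exists>i\<in>I. \<exists>d\<in>P i. 1 / sqrt (\<Sum>i\<in>I. (real (dim (L i)))\<^sup>2) \<le> (\<Sum>i\<in>I. x i) \<bullet> d"
      using x u
      by (intro orthogonal_union_inner_witness[of I L P, OF finI p(1) p(10) p(5) pos part_witness])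
        auto
    then show "\<exists>d\<in>D. 1 / sqrt (\<Sum>i\<in>I. (real (dim (L i)))\<^sup>2) \<le> u \<bullet> d"
      using x(2) p(2) by auto
  qed auto
qed

theorem theorem33:
  fixes D :: "(real^'n) set" and P L :: "nat \<Rightarrow> (real^'n) set"
    and m :: "nat \<Rightarrow> nat" and n s :: nat and J K :: "nat set"
  assumes "n = CARD('n)"
    and "D \<in> Omega_plus s"
    and "Omega_partition s D P L"
    and "pairwise_orthogonal_parts {1..s - n} P"
    and "\<forall>i\<in>{1..s - n}. dim (L i) = m i"
    and "\<forall>i\<in>{1..s - n}. optimal_minimal_sub_positive_basis (P i) (L i)"
    and "J \<inter> K = {}" and "J \<union> K = {1..s - n}"
    and "card J = s - n - n mod (s - n)" and "card K = n mod (s - n)"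
    and "\<forall>j\<in>J. int (m j) = \<lfloor>real n / real (s - n)\<rfloor>"
    and "\<forall>k\<in>K. int (m k) = \<lceil>real n / real (s - n)\<rceil>"
  shows "optimal_over (Omega_plus s) D"
proof -
  let ?I = "{1..s - CARD('n)}"
  have D: "positive_basis D UNIV" "card D = s"
    using assms(2) unfolding Omega_plus_def Omega_def by blast+
  have orthP: "pairwise_orthogonal_parts ?I P" using assms(1,4) by simp
  note p = orthogonal_Omega_partitionD[OF D assms(3) orthP]
  have "cosine_measure D' \<le> cosine_measure D" if D'_in: "D' \<in> Omega_plus s" for D' :: "(real^'n) set"
  proof -
    obtain P' L' where D': "positive_basis D' UNIV" "card D' = s" "Omega_partition s D' P' L'"
        "pairwise_orthogonal_parts ?I P'"
      using D'_in unfolding Omega_plus_def Omega_def by blast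
    note p' = orthogonal_Omega_partitionD[OF D']
    have balanced: "dim (L i) = n div (s - n) \<or> dim (L i) = n div (s - n) + 1" if i: "i \<in> ?I" for i
    proof (rule floor_or_ceiling_of_nat_divide)
      have "i \<in> J \<or> i \<in> K" "dim (L i) = m i" using i assms(1,5,8) by blast+
      then show "int (dim (L i)) = \<lfloor>real n / real (s - n)\<rfloor> \<or> int (dim (L i)) = \<lceil>real n / real (s - n)\<rceil>"
        using assms(11,12) by metis
    qed
    have "(\<Sum>i\<in>?I. dim (L i)) = (\<Sum>i\<in>?I. dim (L' i))" using p(3) p'(3) by (rule trans[OF _ sym])
    with balanced have le: "(\<Sum>i\<in>?I. (real (dim (L i)))\<^sup>2) \<le> (\<Sum>i\<in>?I. (real (dim (L' i)))\<^sup>2)"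
      by (rule balanced_sum_squares_le)
    have "0 < real (dim (L i))" if "i \<in> ?I" for i using p(9)[OF that] by simp
    then have pos: "0 < (\<Sum>i\<in>?I. (real (dim (L i)))\<^sup>2)"
      by (intro sum_pos p(1) zero_less_power) simp_all
    have "1 / sqrt (\<Sum>i\<in>?I. (real (dim (L' i)))\<^sup>2) \<le> 1 / sqrt (\<Sum>i\<in>?I. (real (dim (L i)))\<^sup>2)"
      by (rule frac_le) (simp_all only: real_sqrt_gt_0_iff real_sqrt_le_iff le pos zero_le_one order_refl)
    with orthogonal_Omega_partition_cosine_measure_le[OF D']
    have "cosine_measure D' \<le> 1 / sqrt (\<Sum>i\<in>?I. (real (dim (L i)))\<^sup>2)" by linarith
    also have "\<dots> \<le> cosine_measure D"
    proof (rule optimal_parts_le_cosine_measure[OF D assms(3) orthP])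
      show "optimal_minimal_sub_positive_basis (P i) (L i)" if "i \<in> ?I" for i
        using that assms(1,6) by blast
    qed
    finally show ?thesis .
  qed
  then show ?thesis using D assms(2) unfolding optimal_over_def by blast
qed

end
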